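(* Let $n\ge 2$, let $c:\mathbb{R}^n\times\mathbb{R}^n\to[0,\infty)$ be a cost function that is positive, symmetric, satisfies the triangle inequality, is homogeneous and shift invariant (in the sense specified in the context). Let $y_1,\dots,y_N\in\mathbb{R}^n$ ($N\ge 2$) be distinct points, let $w\in\mathbb{R}^N$, and let $L(y_1),\dots,L(y_N)$ be the associated Laguerre cells. Fix $i\in\{1,\dots,N\}$, let $x\in L(y_i)$ and put $S(t)=t(x-y_i)+y_i$ for $0\le t\le 1$. Then $S(t)\in L(y_i)$ for all $t\in[0,1]$. As a consequence, each Laguerre cell $L(y_i)$ is star-shaped in $\mathbb{R}^n$ with respect to its own target point $y_i$.
   Context: Assumptions on the cost $c$: (positivity) $c(x,y)\ge 0$, and $c(x,y)=0$ if and only if $x=y$; (symmetry) $c(x,y)=c(y,x)$; (triangle inequality) $c(x,y)\le c(x,z)+c(z,y)$; (homogeneity) $c(tx,ty)=|t|\,c(x,y)$ for all $t\in\mathbb{R}$; (shift invariance) $c(x+z,y+z)=c(x,y)$; all for all $x,y,z\in\mathbb{R}^n$. Laguerre cells: $L(y_i)=\{x\in\mathbb{R}^n : c(x,y_i)-w_i\le c(x,y_j)-w_j \text{ for all } j\ne i\}$, $i=1,\dots,N$. The $y_i$ are called target points and $w$ the shift vector. A set is star-shaped with respect to a point $y$ if for each point $x$ of the set, the segment from $y$ to $x$ is contained in the set (vacuously true for the empty set). *)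

theory Defs
  imports "HOL-Analysis.Analysis"
begin

definition homogeneous_cost :: "(real^'n \<Rightarrow> real^'n \<Rightarrow> real) \<Rightarrow> bool" where
  "homogeneous_cost c \<longleftrightarrow>
     (\<forall>x y. c x y \<ge> 0 \<and> (c x y = 0 \<longleftrightarrow> x = y)) \<and>
     (\<forall>x y. c x y = c y x) \<and>
     (\<forall>x y z. c x y \<le> c x z + c z y) \<and>
     (\<forall>t x y. c (t *\<^sub>R x) (t *\<^sub>R y) = \<bar>t\<bar> * c x y) \<and>
     (\<forall>x y z. c (x + z) (y + z) = c x y)"

(* The target points and the shift vector are indexed by a finite type 'k, so N = CARD('k). *)
definition laguerre_cell ::
    "(real^'n \<Rightarrow> real^'n \<Rightarrow> real) \<Rightarrow> ('k::finite \<Rightarrow> real^'n) \<Rightarrow> real^'k \<Rightarrow> 'k \<Rightarrow> (real^'n) set" where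
  "laguerre_cell c y w i = {x. \<forall>j. j \<noteq> i \<longrightarrow> c x (y i) - w $ i \<le> c x (y j) - w $ j}"

(* Unlike the library's starlike, the centre p is prescribed and is not required to lie in S;
   in particular the empty set is star-shaped with respect to every point. *)
definition star_shaped_wrt :: "'a::real_vector set \<Rightarrow> 'a \<Rightarrow> bool" where
  "star_shaped_wrt S p \<longleftrightarrow> (\<forall>x\<in>S. closed_segment p x \<subseteq> S)"

end

(* On the segment from y i to x the cost is additive, c(x, y i) = c(x, S) + c(S, y i).
   So moving from x to S lowers the cost to y i by exactly c(x, S), while by the triangle
   inequality the cost to any other y j drops by at most c(x, S); the inequalities
   defining the cell therefore survive. *)
theory Submission
  imports Defs
begin

text \<open>Shift invariance, applied to the pair \<open>x - y\<close>, \<open>0\<close> with shift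
  \<open>y\<close>: the cost behaves like a norm of the difference.\<close>

lemma homogeneous_cost_diff:
  assumes "homogeneous_cost c"
  shows "c x y = c (x - y) 0"
proof -
  have "c (x - y + y) (0 + y) = c (x - y) 0"
    using assms unfolding homogeneous_cost_def by blast
  then show ?thesis by simp
qed

text \<open>Both costs depend only on differences, so homogeneity applied to \<open>x - y\<close>
  and \<open>0\<close> pulls out the factor. This evaluates the cost between points of one
  line.\<close>

lemma homogeneous_cost_scaled_diff:
  assumes "homogeneous_cost c" and "u - v = s *\<^sub>R (x - y)"
  shows "c u v = \<bar>s\<bar> * c x y"
proof -
  have "c (s *\<^sub>R (x - y)) (s *\<^sub>R 0) = \<bar>s\<bar> * c (x - y) 0"
    using assms(1) unfolding homogeneous_cost_def by blast
  then show ?thesis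
    using assms(2) homogeneous_cost_diff[OF assms(1)] by (metis scaleR_zero_right)
qed

lemma laguerre_cell_segment:
  assumes c: "homogeneous_cost c" and x: "x \<in> laguerre_cell c y w i" and t: "t \<in> {0..1}"
  shows "t *\<^sub>R (x - y i) + y i \<in> laguerre_cell c y w i"
proof -
  define S where "S = t *\<^sub>R (x - y i) + y i"
  \<comment> \<open>Here \<open>S - y i\<close> and \<open>x - S\<close> are the multiples of
    \<open>x - y i\<close> by \<open>t\<close> and \<open>1 - t\<close>. Both factors are
    nonnegative since \<open>t\<close> lies in \<open>{0..1}\<close>, so the absolute values
    disappear and the two costs add up.\<close>
  have "c S (y i) = t * c x (y i)"
    using homogeneous_cost_scaled_diff[OF c, of S "y i" t x "y i"] t by (simp add: S_def)
  moreover have "c x S = (1 - t) * c x (y i)"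
    using homogeneous_cost_scaled_diff[OF c, of x S "1 - t" x "y i"] t
    by (simp add: S_def algebra_simps)
  ultimately have split: "c x (y i) = c x S + c S (y i)"
    by (simp add: algebra_simps)
  have "c S (y i) - w $ i \<le> c S (y j) - w $ j" if "j \<noteq> i" for j
  proof -
    have "c x (y j) \<le> c x S + c S (y j)"
      using c unfolding homogeneous_cost_def by blast
    moreover have "c x (y i) - w $ i \<le> c x (y j) - w $ j"
      using x that by (simp add: laguerre_cell_def)
    ultimately show ?thesis using split by linarith
  qed
  then show ?thesis by (simp add: laguerre_cell_def S_def)
qed

theorem theorem2p12:
  fixes c :: "real^'n \<Rightarrow> real^'n \<Rightarrow> real"
    and y :: "'k::finite \<Rightarrow> real^'n"
    and w :: "real^'k"
  assumes "CARD('n) \<ge> 2"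
    and "CARD('k) \<ge> 2"
    and "homogeneous_cost c"
    and "inj y"
  shows "(\<forall>i. \<forall>x \<in> laguerre_cell c y w i. \<forall>t \<in> {0..1}.
            t *\<^sub>R (x - y i) + y i \<in> laguerre_cell c y w i) \<and>
         (\<forall>i. star_shaped_wrt (laguerre_cell c y w i) (y i))"
proof -
  have seg: "t *\<^sub>R (x - y i) + y i \<in> laguerre_cell c y w i"
    if "x \<in> laguerre_cell c y w i" "t \<in> {0..1}" for i x t
    using laguerre_cell_segment[OF assms(3) that] .
  have "closed_segment (y i) x \<subseteq> laguerre_cell c y w i"
    if x: "x \<in> laguerre_cell c y w i" for i x
  proof
    fix z assume "z \<in> closed_segment (y i) x"
    \<comment> \<open>With \<open>y i\<close> as the first endpoint, the weight \<open>t\<close>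
      falls on \<open>x\<close>, so it is the very parameter used in \<open>seg\<close>.\<close>
    then obtain t where t: "0 \<le> t" "t \<le> 1" and "z = (1 - t) *\<^sub>R y i + t *\<^sub>R x"
      by (auto simp: in_segment)
    then have "z = t *\<^sub>R (x - y i) + y i" by (simp add: algebra_simps)
    then show "z \<in> laguerre_cell c y w i" using seg[OF x] t by simp
  qed
  with seg show ?thesis by (simp add: star_shaped_wrt_def)
qed

end
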